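(* Let $f,h:\mathbb{R}^d\to\mathbb{R}$ be differentiable with $\nabla f$ Lipschitz continuous with constant $L_f$ and $\nabla h$ Lipschitz continuous with constant $L_h$, let $g:\mathbb{R}^d\to\mathbb{R}\cup\{+\infty\}$ be proper, lower semicontinuous, prox-bounded with threshold $\gamma_g>0$, and $\rho$-weakly convex for some $\rho\ge 0$, and suppose that $\varphi:=f+g+h$ has a nonempty set of minimisers. Then, for any sequence of positive numbers $\gamma_k\downarrow 0$, the functions $\varphi^{\rm DY}_{\gamma_k}$ epi-converge to $\varphi$ as $k\to\infty$.
   Context: A function $\phi$ is $\rho$-weakly convex if $\phi+\frac{\rho}{2}\|\cdot\|^2$ is convex. A function $g$ is prox-bounded with threshold $\gamma_g>0$ if $g+\frac{1}{2\gamma_g}\|\cdot\|^2$ is bounded from below. For $\gamma>0$ the Davis-Yin envelope is $$\varphi_\gamma^{\rm DY}(x):=\inf_{y\in\mathbb{R}^d}\Big\{f(x)+\langle\nabla f(x),y-x\rangle+h(x)+\langle\nabla h(x),y-x\rangle+g(y)+\frac{1}{2\gamma}\|y-x\|^2\Big\},\quad x\in\mathbb{R}^d.$$ A sequence of extended-real-valued functions $\phi^k$ epi-converges to $\phi$ if the epigraphs $C^k=\mathrm{epi}(\phi^k)$ set-converge to $C=\mathrm{epi}(\phi)$ in the Painlevé-Kuratowski sense: $\limsup_k C^k\subseteq C\subseteq\liminf_k C^k$, where $\liminf_k C^k$ is the set of limits of sequences $(x^k)$ with $x^k\in C^k$ for all $k$, and $\limsup_k C^k$ is the set of limits of sequences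 taken from $C^{k_j}$ along subsequences $(k_j)$. *)

theory Defs
  imports "HOL-Analysis.Analysis"
begin

definition grad :: "('a::real_inner \<Rightarrow> real) \<Rightarrow> 'a \<Rightarrow> 'a" where
  "grad f x = (THE D. GDERIV f x :> D)"

lemma GDERIV_unique:
  assumes "GDERIV f x :> D" and "GDERIV f x :> E"
  shows "D = E"
proof -
  have "(\<lambda>h. inner h D) = (\<lambda>h. inner h E)"
    using assms unfolding gderiv_def by (rule has_derivative_unique)
  then have "inner (D - E) D = inner (D - E) E"
    by meson
  then have "inner (D - E) (D - E) = 0"
    by (simp add: inner_diff_right)
  then show ?thesis
    by simp
qed

lemma GDERIV_grad:
  fixes f :: "'a::euclidean_space \<Rightarrow> real"
  assumes "f differentiable (at x)"
  shows "GDERIV f x :> grad f x"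
proof -
  obtain f' where f': "(f has_derivative f') (at x)"
    using assms by (auto simp: differentiable_def)
  then have lin: "linear f'"
    by (rule has_derivative_linear)
  have "f' = (\<lambda>h. inner h (adjoint f' 1))"
    using adjoint_works[OF lin] by (auto simp: fun_eq_iff)
  with f' have "GDERIV f x :> adjoint f' 1"
    by (simp add: gderiv_def)
  then show ?thesis
    unfolding grad_def using GDERIV_unique by (metis theI)
qed

definition proper :: "('a \<Rightarrow> ereal) \<Rightarrow> bool" where
  "proper \<phi> \<longleftrightarrow> (\<forall>x. \<phi> x \<noteq> -\<infinity>) \<and> (\<exists>x. \<phi> x \<noteq> \<infinity>)"

definition lower_semicontinuous :: "('a::topological_space \<Rightarrow> ereal) \<Rightarrow> bool" where
  "lower_semicontinuous \<phi> \<longleftrightarrow> (\<forall>x. \<phi> x \<le> Liminf (at x) \<phi>)"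

text \<open>
  The analogue of \<^const>\<open>convex_on\<close> on the whole space. It is meant for functions that do not
  take the value \<open>-\<infinity>\<close>, so the right-hand side never contains \<open>\<infinity> - \<infinity>\<close>;
  a term with coefficient \<open>0\<close> vanishes because \<open>0 * \<infinity> = 0\<close> in \<^typ>\<open>ereal\<close>.
\<close>
definition convex_ereal :: "('a::real_vector \<Rightarrow> ereal) \<Rightarrow> bool" where
  "convex_ereal \<phi> \<longleftrightarrow>
     (\<forall>x y. \<forall>u\<ge>0. \<forall>v\<ge>0. u + v = 1 \<longrightarrow>
        \<phi> (u *\<^sub>R x + v *\<^sub>R y) \<le> ereal u * \<phi> x + ereal v * \<phi> y)"

definition weakly_convex :: "real \<Rightarrow> ('a::real_normed_vector \<Rightarrow> ereal) \<Rightarrow> bool" where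
  "weakly_convex \<rho> \<phi> \<longleftrightarrow> convex_ereal (\<lambda>x. \<phi> x + ereal (\<rho> / 2 * (norm x)\<^sup>2))"

definition prox_bounded :: "real \<Rightarrow> ('a::real_normed_vector \<Rightarrow> ereal) \<Rightarrow> bool" where
  "prox_bounded \<gamma> \<phi> \<longleftrightarrow>
     (\<exists>m::real. \<forall>x. ereal m \<le> \<phi> x + ereal (1 / (2 * \<gamma>) * (norm x)\<^sup>2))"

definition minimisers :: "('a \<Rightarrow> ereal) \<Rightarrow> 'a set" where
  "minimisers \<phi> = {x. \<forall>y. \<phi> x \<le> \<phi> y}"

definition DY_envelope ::
  "('a::real_inner \<Rightarrow> real) \<Rightarrow> ('a \<Rightarrow> ereal) \<Rightarrow> ('a \<Rightarrow> real) \<Rightarrow> real \<Rightarrow> 'a \<Rightarrow> ereal" where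
  "DY_envelope f g h \<gamma> x =
     (INF y. ereal (f x + inner (grad f x) (y - x) + h x + inner (grad h x) (y - x))
              + g y + ereal (1 / (2 * \<gamma>) * (norm (y - x))\<^sup>2))"

definition epi :: "('a \<Rightarrow> ereal) \<Rightarrow> ('a \<times> real) set" where
  "epi \<phi> = {(x, r). \<phi> x \<le> ereal r}"

definition PK_liminf :: "(nat \<Rightarrow> 'a::topological_space set) \<Rightarrow> 'a set" where
  "PK_liminf C = {z. \<exists>Z. (\<forall>k. Z k \<in> C k) \<and> Z \<longlonglongrightarrow> z}"

definition PK_limsup :: "(nat \<Rightarrow> 'a::topological_space set) \<Rightarrow> 'a set" where
  "PK_limsup C =
     {z. \<exists>(r :: nat \<Rightarrow> nat) Z. strict_mono r \<and> (\<forall>j. Z j \<in> C (r j)) \<and> Z \<longlonglongrightarrow> z}"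

definition PK_converges :: "(nat \<Rightarrow> 'a::topological_space set) \<Rightarrow> 'a set \<Rightarrow> bool" where
  "PK_converges C S \<longleftrightarrow> PK_limsup C \<subseteq> S \<and> S \<subseteq> PK_liminf C"

definition epi_converges ::
  "(nat \<Rightarrow> 'a::topological_space \<Rightarrow> ereal) \<Rightarrow> ('a \<Rightarrow> ereal) \<Rightarrow> bool" where
  "epi_converges \<Phi> \<phi> \<longleftrightarrow> PK_converges (\<lambda>k. epi (\<Phi> k)) (epi \<phi>)"

end

theory Submission
  imports Defs
begin

text \<open>
  The choice \<open>y = x\<close> in the infimum shows that the envelope lies below \<open>\<phi>\<close>, which gives the
  lower-limit inclusion with constant sequences. For the upper limit, let \<open>x\<^sub>j \<rightarrow> x\<close> and
  \<open>s < \<phi> x\<close>. For \<open>y\<close> near \<open>x\<close>, lower semicontinuity bounds \<open>g y\<close> from below and the quadratic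
  absorbs the linear term up to \<open>O(\<gamma>)\<close>; for \<open>y\<close> away from \<open>x\<close>, the quadratic with coefficient
  \<open>1/(2\<gamma>) \<rightarrow> \<infinity>\<close> dominates both the linear term and the quadratic minorant of \<open>g\<close>.
  Hence the envelopes at \<open>x\<^sub>j\<close> eventually exceed \<open>s\<close>.
\<close>

lemma DY_envelope_le:
  "DY_envelope f g h \<gamma> x \<le> ereal (f x) + g x + ereal (h x)"
proof -
  have "DY_envelope f g h \<gamma> x \<le>
      ereal (f x + inner (grad f x) (x - x) + h x + inner (grad h x) (x - x))
        + g x + ereal (1 / (2 * \<gamma>) * (norm (x - x))\<^sup>2)"
    unfolding DY_envelope_def by (rule INF_lower) simp
  also have "\<dots> = ereal (f x) + g x + ereal (h x)"
    by (cases "g x") auto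
  finally show ?thesis .
qed

text \<open>\<open>Liminf (at x) g\<close> only sees the punctured neighbourhood of
  \<open>x\<close>; the second assumption supplies the bound at the centre.\<close>

lemma lower_semicontinuous_ball:
  fixes g :: "'a::metric_space \<Rightarrow> ereal"
  assumes "lower_semicontinuous g" and "c < g x"
  obtains \<delta> where "\<delta> > 0" and "\<And>y. dist y x < \<delta> \<Longrightarrow> c < g y"
proof -
  have "c < Liminf (at x) g"
    using assms by (auto simp: lower_semicontinuous_def intro: less_le_trans)
  then have "eventually (\<lambda>y. c < g y) (at x)"
    by (rule less_LiminfD)
  then obtain \<delta> where "\<delta> > 0" and "\<And>y. y \<noteq> x \<Longrightarrow> dist y x < \<delta> \<Longrightarrow> c < g y"
    unfolding eventually_at by auto
  with assms(2) that show thesis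
    by metis
qed

lemma prox_bounded_minorant:
  assumes "prox_bounded \<gamma> g"
  obtains m where "\<And>y. ereal (m - (norm y)\<^sup>2 / (2 * \<gamma>)) \<le> g y"
proof -
  obtain m where m: "\<And>y. ereal m \<le> g y + ereal (1 / (2 * \<gamma>) * (norm y)\<^sup>2)"
    using assms by (auto simp: prox_bounded_def)
  have "ereal (m - (norm y)\<^sup>2 / (2 * \<gamma>)) \<le> g y" for y
    using m[of y] by (cases "g y") auto
  then show thesis
    by (rule that)
qed

text \<open>Completing the square, with the minimum at \<open>t = \<gamma> * M\<close>. The bound is
  uniform in \<open>t\<close> and vanishes with \<gamma>.\<close>

lemma linear_plus_quadratic_ge:
  fixes M t \<gamma> :: real
  assumes "\<gamma> > 0"
  shows "- (M * t) + t\<^sup>2 / (2 * \<gamma>) \<ge> - (\<gamma> * M\<^sup>2 / 2)"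
proof -
  have "t\<^sup>2 / (2 * \<gamma>) - M * t + \<gamma> * M\<^sup>2 / 2 = (t - \<gamma> * M)\<^sup>2 / (2 * \<gamma>)"
    using assms by (simp add: field_simps power2_eq_square)
  also have "\<dots> \<ge> 0"
    using assms by simp
  finally show ?thesis
    by simp
qed

text \<open>This is the lower-limit inequality of epi-convergence. The threshold on \<open>j\<close>
  is found before \<open>y\<close> is fixed, so the bound on each term passes to the infimum. The
  arbitrary filter lets \<gamma> be a subsequence paired with its own points
  \<open>X j\<close>.\<close>

lemma eventually_le_DY_envelope:
  fixes f h :: "'a::real_inner \<Rightarrow> real" and X :: "'b \<Rightarrow> 'a"
  assumes lsc: "lower_semicontinuous g"
    and \<gamma>\<^sub>g: "\<gamma>\<^sub>g > 0" and prox: "prox_bounded \<gamma>\<^sub>g g"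
    and X: "(X \<longlongrightarrow> x) F"
    and f: "isCont f x" "isCont (grad f) x"
    and h: "isCont h x" "isCont (grad h) x"
    and \<gamma>: "filterlim \<gamma> (at_right 0) F"
    and s: "ereal s < ereal (f x) + g x + ereal (h x)"
  shows "eventually (\<lambda>j. ereal s \<le> DY_envelope f g h (\<gamma> j) (X j)) F"
proof -
  have "ereal (s - f x - h x) < g x"
    using s by (cases "g x") auto
  \<comment> \<open>The real \<open>c\<close> stands in for \<open>g x\<close>, which may be
    infinite.\<close>
  then obtain c where c: "s - f x - h x < c" "ereal c < g x"
    using ereal_dense2 by fastforce
  obtain \<delta> where \<delta>: "\<delta> > 0" "\<And>y. dist y x < \<delta> \<Longrightarrow> ereal c < g y"
    using lower_semicontinuous_ball[OF lsc c(2)] by blast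
  obtain m where m: "\<And>y. ereal (m - (norm y)\<^sup>2 / (2 * \<gamma>\<^sub>g)) \<le> g y"
    using prox_bounded_minorant[OF prox] by blast
  define G where "G y = grad f y + grad h y" for y
  \<comment> \<open>The added 1 leaves strict room, so that \<open>M\<close> bounds
    \<open>norm (G (X j))\<close> eventually; \<open>N\<close> bounds \<open>norm (X j)\<close> once
    \<open>X j\<close> is within \<open>\<delta> / 2\<close> of \<open>x\<close>.\<close>
  define M where "M = norm (G x) + 1"
  define N where "N = norm x + \<delta> / 2"
  \<comment> \<open>Half of the slack: one \<open>e\<close> pays for replacing \<open>x\<close> by
    \<open>X j\<close> in \<open>f + h\<close>, the other for the linear term when \<open>y\<close>
    is near \<open>x\<close>.\<close>
  define e where "e = (f x + h x + c - s) / 2"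
  \<comment> \<open>For \<open>y\<close> far from \<open>x\<close>, \<open>B\<close> collects the
    constant terms of the lower bound and \<kappa> the coefficient of \<open>t\<^sup>2\<close> lost
    to the linear term and to the minorant of \<open>g\<close>. As
    \<open>t \<ge> \<delta> / 2\<close> there, the excess of \<open>K\<close> over \<kappa> gains at
    least \<open>\<bar>s - B\<bar>\<close>.\<close>
  define B where "B = f x + h x - e + m - N\<^sup>2 / \<gamma>\<^sub>g"
  define \<kappa> where "\<kappa> = 1 / \<gamma>\<^sub>g + 2 * M / \<delta>"
  define K where "K = \<kappa> + 4 * \<bar>s - B\<bar> / \<delta>\<^sup>2"
  have s_eq: "s = f x + h x + c - 2 * e"
    by (simp add: e_def field_simps)
  have e: "e > 0" and M: "M > 0"
    using c(1) by (auto simp: e_def M_def intro: add_nonneg_pos)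
  have \<gamma>0: "(\<gamma> \<longlongrightarrow> 0) F" and ev_pos: "eventually (\<lambda>j. \<gamma> j > 0) F"
    using \<gamma> by (auto simp: filterlim_at elim: eventually_mono)
  have "((\<lambda>j. f (X j) + h (X j)) \<longlongrightarrow> f x + h x) F"
    by (intro tendsto_add isCont_tendsto_compose[OF f(1) X] isCont_tendsto_compose[OF h(1) X])
  then have ev_fh: "eventually (\<lambda>j. f (X j) + h (X j) > f x + h x - e) F"
    by (rule order_tendstoD) (use e in simp)
  have "((\<lambda>j. norm (G (X j))) \<longlongrightarrow> norm (G x)) F"
    unfolding G_def
    by (intro tendsto_norm tendsto_add isCont_tendsto_compose[OF f(2) X]
        isCont_tendsto_compose[OF h(2) X])
  then have ev_G: "eventually (\<lambda>j. norm (G (X j)) < M) F"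
    by (rule order_tendstoD) (simp add: M_def)
  have ev_X: "eventually (\<lambda>j. dist (X j) x < \<delta> / 2) F"
    using X by (rule tendstoD) (use \<delta>(1) in simp)
  have "((\<lambda>j. \<gamma> j * M\<^sup>2 / 2) \<longlongrightarrow> 0 * M\<^sup>2 / 2) F"
    by (intro tendsto_intros \<gamma>0) simp
  then have ev_\<gamma>: "eventually (\<lambda>j. \<gamma> j * M\<^sup>2 / 2 < e) F"
    by (rule order_tendstoD) (use e in simp)
  have "filterlim (\<lambda>j. inverse (\<gamma> j)) at_top F"
    by (rule filterlim_compose[OF filterlim_inverse_at_top_right \<gamma>])
  then have "eventually (\<lambda>j. 2 * K \<le> inverse (\<gamma> j)) F"
    by (simp add: filterlim_at_top)
  then have ev_K: "eventually (\<lambda>j. K \<le> 1 / (2 * \<gamma> j)) F"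
    by eventually_elim (simp add: field_simps)
  show ?thesis
    using ev_pos ev_fh ev_G ev_X ev_\<gamma> ev_K
  proof eventually_elim
    case (elim j)
    let ?x = "X j" and ?q = "1 / (2 * \<gamma> j)"
    have "ereal s \<le> ereal (f ?x + inner (grad f ?x) (y - ?x) + h ?x + inner (grad h ?x) (y - ?x))
              + g y + ereal (?q * (norm (y - ?x))\<^sup>2)" for y
    proof -
      define t where "t = norm (y - ?x)"
      have t: "t \<ge> 0"
        by (simp add: t_def)
      have "\<bar>inner (G ?x) (y - ?x)\<bar> \<le> M * t"
        unfolding t_def
        by (rule order_trans[OF Cauchy_Schwarz_ineq2]) (use elim in \<open>simp add: mult_right_mono\<close>)
      then have lin: "inner (grad f ?x) (y - ?x) + inner (grad h ?x) (y - ?x) \<ge> - (M * t)"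
        by (simp add: G_def inner_add_left abs_le_iff)
      \<comment> \<open>A finite \<open>v\<close> below \<open>g y\<close> keeps the estimates in
        the reals even where \<open>g y\<close> is infinite: \<open>c\<close> serves near
        \<open>x\<close>, the quadratic minorant elsewhere.\<close>
      have "\<exists>v. ereal v \<le> g y \<and> s \<le> f ?x + h ?x - M * t + v + ?q * t\<^sup>2"
      proof (cases "dist y x < \<delta>")
        case True
        have "- (M * t) + ?q * t\<^sup>2 \<ge> - e"
          using linear_plus_quadratic_ge[of "\<gamma> j" M t] elim by simp
        then have "s \<le> f ?x + h ?x - M * t + c + ?q * t\<^sup>2"
          using elim(2) s_eq by linarith
        with \<delta>(2)[OF True] show ?thesis
          by (auto intro: less_imp_le)
      next
        case False
        have "dist y x \<le> t + dist ?x x"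
          using dist_triangle[of y x ?x] by (simp add: t_def dist_norm)
        \<comment> \<open>The cases are split by distance to the fixed \<open>x\<close>, whereas
          \<open>t\<close> is the distance to \<open>X j\<close>; half of \<delta> survives the
          change of centre.\<close>
        with False elim have t_ge: "t \<ge> \<delta> / 2"
          by simp
        have "norm ?x \<le> N"
          using norm_triangle_sub[of ?x x] elim by (simp add: N_def dist_norm)
        then have "norm y \<le> N + t"
          using norm_triangle_sub[of y ?x] by (simp add: t_def)
        then have "(norm y)\<^sup>2 \<le> (N + t)\<^sup>2"
          by (simp add: power_mono)
        also have "\<dots> \<le> 2 * N\<^sup>2 + 2 * t\<^sup>2"
          using sum_squares_bound[of N t] by (simp add: power2_sum)
        finally have "(norm y)\<^sup>2 / (2 * \<gamma>\<^sub>g) \<le> (2 * N\<^sup>2 + 2 * t\<^sup>2) / (2 * \<gamma>\<^sub>g)"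
          using \<gamma>\<^sub>g by (intro divide_right_mono) auto
        also have "\<dots> = N\<^sup>2 / \<gamma>\<^sub>g + t\<^sup>2 / \<gamma>\<^sub>g"
          using \<gamma>\<^sub>g by (simp add: field_simps)
        finally have y: "(norm y)\<^sup>2 / (2 * \<gamma>\<^sub>g) \<le> N\<^sup>2 / \<gamma>\<^sub>g + t\<^sup>2 / \<gamma>\<^sub>g" .
        \<comment> \<open>Since \<open>t\<close> is bounded away from 0, a linear term is dominated
          by a multiple of \<open>t\<^sup>2\<close>.\<close>
        have "M * (\<delta> / 2) * t \<le> M * t * t"
          using mult_right_mono[OF mult_left_mono[OF t_ge, of M], of t] M t by simp
        then have "M * t \<le> 2 * M / \<delta> * t\<^sup>2"
          using \<delta>(1) by (simp add: field_simps power2_eq_square)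
        then have 1: "M * t + t\<^sup>2 / \<gamma>\<^sub>g \<le> \<kappa> * t\<^sup>2"
          by (simp add: \<kappa>_def algebra_simps)
        have "\<bar>s - B\<bar> = 4 * \<bar>s - B\<bar> / \<delta>\<^sup>2 * (\<delta> / 2)\<^sup>2"
          using \<delta>(1) by (simp add: field_simps power2_eq_square)
        also have "\<dots> \<le> 4 * \<bar>s - B\<bar> / \<delta>\<^sup>2 * t\<^sup>2"
          using t_ge \<delta>(1) by (intro mult_left_mono power_mono) auto
        also have "\<dots> = K * t\<^sup>2 - \<kappa> * t\<^sup>2"
          by (simp add: K_def algebra_simps)
        also have "K * t\<^sup>2 \<le> ?q * t\<^sup>2"
          using elim by (intro mult_right_mono) auto
        finally have "s - B \<le> ?q * t\<^sup>2 - \<kappa> * t\<^sup>2"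
          by simp
        with 1 y elim
        have "s \<le> f ?x + h ?x - M * t + (m - (norm y)\<^sup>2 / (2 * \<gamma>\<^sub>g)) + ?q * t\<^sup>2"
          by (simp add: B_def)
        with m[of y] show ?thesis
          by blast
      qed
      then obtain v where v: "ereal v \<le> g y" "s \<le> f ?x + h ?x - M * t + v + ?q * t\<^sup>2"
        by blast
      have "s \<le> f ?x + inner (grad f ?x) (y - ?x) + h ?x + inner (grad h ?x) (y - ?x) + v
              + ?q * t\<^sup>2"
        using v(2) lin by linarith
      then have "ereal s \<le> ereal (f ?x + inner (grad f ?x) (y - ?x) + h ?x
              + inner (grad h ?x) (y - ?x)) + ereal v + ereal (?q * t\<^sup>2)"
        by simp
      also have "\<dots> \<le> ereal (f ?x + inner (grad f ?x) (y - ?x) + h ?x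
              + inner (grad h ?x) (y - ?x)) + g y + ereal (?q * t\<^sup>2)"
        by (intro add_mono v(1) order_refl)
      finally show ?thesis
        by (simp only: t_def)
    qed
    then show ?case
      unfolding DY_envelope_def by (intro INF_greatest)
  qed
qed

theorem proposition1:
  fixes f h :: "'a::euclidean_space \<Rightarrow> real"
    and g :: "'a \<Rightarrow> ereal"
    and L\<^sub>f L\<^sub>h \<gamma>\<^sub>g \<rho> :: real
    and \<phi> :: "'a \<Rightarrow> ereal"
    and \<gamma> :: "nat \<Rightarrow> real"
  assumes f_diff: "\<And>x. f differentiable (at x)"
    and f_lip: "L\<^sub>f-lipschitz_on UNIV (grad f)"
    and h_diff: "\<And>x. h differentiable (at x)"
    and h_lip: "L\<^sub>h-lipschitz_on UNIV (grad h)"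
    and g_proper: "proper g"
    and g_lsc: "lower_semicontinuous g"
    and \<gamma>\<^sub>g_pos: "\<gamma>\<^sub>g > 0"
    and g_prox: "prox_bounded \<gamma>\<^sub>g g"
    and \<rho>_nonneg: "\<rho> \<ge> 0"
    and g_wc: "weakly_convex \<rho> g"
    and \<phi>_eq: "\<phi> = (\<lambda>x. ereal (f x) + g x + ereal (h x))"
    and \<phi>_min: "minimisers \<phi> \<noteq> {}"
    and \<gamma>_pos: "\<And>k. \<gamma> k > 0"
    and \<gamma>_lim: "\<gamma> \<longlonglongrightarrow> 0"
  shows "epi_converges (\<lambda>k. DY_envelope f g h (\<gamma> k)) \<phi>"
proof -
  have cont: "isCont f x" "isCont (grad f) x" "isCont h x" "isCont (grad h) x" for x
    using f_diff h_diff lipschitz_on_continuous_on[OF f_lip] lipschitz_on_continuous_on[OF h_lip]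
    by (auto simp: differentiable_imp_continuous_within continuous_on_eq_continuous_at)
  have "z \<in> epi \<phi>" if limsup: "z \<in> PK_limsup (\<lambda>k. epi (DY_envelope f g h (\<gamma> k)))" for z
  proof (rule ccontr)
    obtain x r where z: "z = (x, r)"
      by (cases z)
    obtain n Z where n: "strict_mono (n :: nat \<Rightarrow> nat)" and Z: "Z \<longlonglongrightarrow> z"
      and in_epi: "\<And>j. Z j \<in> epi (DY_envelope f g h (\<gamma> (n j)))"
      using limsup unfolding PK_limsup_def by blast
    assume "z \<notin> epi \<phi>"
    \<comment> \<open>The level \<open>s\<close> separates the heights \<open>snd (Z j)\<close>,
      which tend to \<open>r\<close>, from the envelope values at \<open>fst (Z j)\<close>, which
      are eventually at least \<open>s\<close>; membership in the epigraphs forbids this.\<close>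
    then obtain s where s: "r < s" "ereal s < \<phi> x"
      using ereal_dense2[of "ereal r" "\<phi> x"] by (auto simp: epi_def z not_le)
    have "(\<lambda>j. \<gamma> (n j)) \<longlonglongrightarrow> 0"
      using LIMSEQ_subseq_LIMSEQ[OF \<gamma>_lim n] by (simp add: o_def)
    then have "filterlim (\<lambda>j. \<gamma> (n j)) (at_right 0) sequentially"
      using \<gamma>_pos by (intro tendsto_imp_filterlim_at_right) auto
    moreover have "(\<lambda>j. fst (Z j)) \<longlonglongrightarrow> x"
      using tendsto_fst[OF Z] by (simp add: z)
    ultimately have "\<forall>\<^sub>F j in sequentially. ereal s \<le> DY_envelope f g h (\<gamma> (n j)) (fst (Z j))"
      using s(2) unfolding \<phi>_eq
      by (intro eventually_le_DY_envelope[OF g_lsc \<gamma>\<^sub>g_pos g_prox] cont)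
    moreover have "\<forall>\<^sub>F j in sequentially. snd (Z j) < s"
      using order_tendstoD(2)[OF tendsto_snd[OF Z]] s(1) by (simp add: z)
    ultimately have "\<forall>\<^sub>F j in sequentially. False"
    proof eventually_elim
      case (elim j)
      have "DY_envelope f g h (\<gamma> (n j)) (fst (Z j)) \<le> ereal (snd (Z j))"
        using in_epi[of j] by (auto simp: epi_def)
      with elim(1) have "ereal s \<le> ereal (snd (Z j))"
        by (rule order_trans)
      with elim(2) show ?case
        by simp
    qed
    then show False
      by simp
  qed
  moreover have "z \<in> PK_liminf (\<lambda>k. epi (DY_envelope f g h (\<gamma> k)))" if "z \<in> epi \<phi>" for z
  proof -
    have "z \<in> epi (DY_envelope f g h (\<gamma> k))" for k
      using that order_trans[OF DY_envelope_le] by (fastforce simp: epi_def \<phi>_eq)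
    then show ?thesis
      unfolding PK_liminf_def by (auto intro!: exI[of _ "\<lambda>_. z"])
  qed
  ultimately show ?thesis
    by (auto simp: epi_converges_def PK_converges_def)
qed

end
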